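(* Let $\Sigma$ be a finite alphabet, let $n\ge 1$ be an integer, and let $\mathcal{M}\subset\mathbb{R}^{\Sigma^*}$ be a class of unconstrained stochastic string functions such that (i) $\mathrm{SLC}(\mathcal{M})\le n-1<\infty$; (ii) if $p\in\mathcal{M}$ then $p^a\in\mathcal{M}$ for all $a\in\Sigma$. Then for every family of real numbers $(p(u))_{u\in\Sigma^{n+1}}$, setting $p(v):=\sum_{a\in\Sigma}p(va)$ for $v\in\Sigma^n$, one has $$(p(u))_{u\in\Sigma^{n+1}}\in\mathcal{M}_{n+1}\iff (p(av))_{v\in\Sigma^n}\in\mathcal{M}_n\ \text{ for all } a\in\Sigma\ \text{ and }\ (p(v))_{v\in\Sigma^n}\in\mathcal{M}_n.$$
   Context: $\Sigma^*=\bigcup_{t\ge0}\Sigma^t$ is the set of finite strings over $\Sigma$ (including the empty string $\Box$), with concatenation written $wv$. A string function is a map $p:\Sigma^*\to\mathbb{R}$. It is an unconstrained stochastic string function (USSF, or unconstrained random process) if $p(v)\ge0$ and $\sum_{a\in\Sigma}p(va)=p(v)$ for all $v\in\Sigma^*$. For a string function $p$ and $w\in\Sigma^*$, $p^w:\Sigma^*\to\mathbb{R}$ is the string function $p^w(v):=p(wv)$. For a class $\mathcal{M}$ of USSFs, its string length complexity is $$\mathrm{SLC}(\mathcal{M}):=\inf\{N\in\mathbb{N}\mid \forall p_1,p_2\in\mathcal{M}:\ p_1|_{\Sigma^N}=p_2|_{\Sigma^N}\Rightarrow p_1=p_2\},$$ and $\mathcal{M}_n:=\{(p(v))_{v\in\Sigma^n}\mid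 p\in\mathcal{M}\}$. *)

theory Defs
  imports Complex_Main "HOL-Library.FuncSet" "HOL-Library.Extended_Nat"
begin

text \<open>The finite alphabet is a type \<open>'a :: finite\<close>, so that \<open>'a list\<close> is the set of all
  finite strings and a string function is a map \<open>'a list \<Rightarrow> real\<close>.\<close>

definition words :: "nat \<Rightarrow> 'a list set" where
  "words t = {v. length v = t}"

definition USSF :: "('a::finite list \<Rightarrow> real) \<Rightarrow> bool" where
  "USSF p \<longleftrightarrow> (\<forall>v. p v \<ge> 0 \<and> (\<Sum>a\<in>UNIV. p (v @ [a])) = p v)"

definition shift :: "'a list \<Rightarrow> ('a list \<Rightarrow> real) \<Rightarrow> 'a list \<Rightarrow> real" where
  "shift w p = (\<lambda>v. p (w @ v))"

text \<open>The infimum is taken in \<open>enat\<close>, so the complexity is \<open>\<infinity>\<close> if no length suffices.\<close>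

definition SLC :: "('a list \<Rightarrow> real) set \<Rightarrow> enat" where
  "SLC M = Inf (enat ` {N. \<forall>p1\<in>M. \<forall>p2\<in>M.
     restrict p1 (words N) = restrict p2 (words N) \<longrightarrow> p1 = p2})"

text \<open>A real family indexed by the words of length \<open>n\<close> is an extensional function on
  \<open>words n\<close>, i.e. one that is \<open>undefined\<close> elsewhere.\<close>

definition marginals :: "('a list \<Rightarrow> real) set \<Rightarrow> nat \<Rightarrow> ('a list \<Rightarrow> real) set" where
  "marginals M n = (\<lambda>p. restrict p (words n)) ` M"

end

theory Submission
  imports Defs
begin

text \<open>For the nontrivial direction, let \<open>q\<close> and \<open>r\<close> in \<open>M\<close> extend the given marginal family and
  its slice at the letter \<open>a\<close>. Summing out the last letter shows that \<open>q\<^sup>a\<close> and \<open>r\<close> agree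
  on words of length \<open>n - 1\<close>; both belong to \<open>M\<close>, so the complexity bound forces \<open>q\<^sup>a = r\<close>.
  Hence \<open>q\<close> itself realizes the family on words of length \<open>n + 1\<close>.\<close>

lemma restrict_words_eq_iff:
  "restrict f (words k) = restrict g (words k) \<longleftrightarrow> (\<forall>v. length v = k \<longrightarrow> f v = g v)"
  by (auto simp: words_def restrict_def fun_eq_iff)

lemma mem_marginals_iff:
  "restrict f (words k) \<in> marginals M k \<longleftrightarrow> (\<exists>q\<in>M. \<forall>v. length v = k \<longrightarrow> f v = q v)"
  by (auto simp: marginals_def restrict_words_eq_iff)

lemma USSF_sum: "USSF p \<Longrightarrow> (\<Sum>a\<in>UNIV. p (v @ [a])) = p v"
  by (simp add: USSF_def)

text \<open>Values at length \<open>m\<close> are sums of values at length \<open>Suc m\<close>, so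
  agreement descends one length at a time from \<open>k\<close> to \<open>N\<close>.\<close>

lemma USSF_eq_on_shorter_words:
  assumes "USSF p" "USSF q" "N \<le> k"
    and "\<And>v. length v = k \<Longrightarrow> p v = q v"
    and "length v = N"
  shows "p v = q v"
  using assms(3,5)
proof (induction N arbitrary: v rule: inc_induct)
  case base
  then show ?case using assms(4) by blast
next
  case (step m)
  have "p v = (\<Sum>a\<in>UNIV. p (v @ [a]))"
    using assms(1) by (simp add: USSF_sum)
  also have "\<dots> = (\<Sum>a\<in>UNIV. q (v @ [a]))"
    using step by simp
  also have "\<dots> = q v"
    using assms(2) by (simp add: USSF_sum)
  finally show ?case .
qed

text \<open>The bound only yields some determining length \<open>N \<le> k\<close>, so agreement at
  length \<open>k\<close> must first be carried down to \<open>N\<close>.\<close>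

lemma SLC_le_imp_eq:
  assumes "SLC M \<le> enat k"
    and "\<And>q. q \<in> M \<Longrightarrow> USSF q"
    and "p \<in> M" "q \<in> M"
    and "\<And>v. length v = k \<Longrightarrow> p v = q v"
  shows "p = q"
proof -
  let ?S = "{N. \<forall>p1\<in>M. \<forall>p2\<in>M. restrict p1 (words N) = restrict p2 (words N) \<longrightarrow> p1 = p2}"
  \<comment> \<open>A strict bound on the infimum produces an element of the set below it; in
    particular the set is nonempty.\<close>
  have "Inf (enat ` ?S) < enat (Suc k)"
    using assms(1) unfolding SLC_def by (rule order.strict_trans1) simp
  then obtain N where N: "N \<in> ?S" "N \<le> k"
    by (auto simp only: Inf_less_iff image_iff enat_ord_simps less_Suc_eq_le bex_simps)
  have "restrict p (words N) = restrict q (words N)"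
    unfolding restrict_words_eq_iff
    using USSF_eq_on_shorter_words[OF assms(2)[OF assms(3)] assms(2)[OF assms(4)] N(2) assms(5)]
    by blast
  then show ?thesis
    using N(1) assms(3,4) by blast
qed

theorem theorem4p2:
  fixes M :: "('a::finite list \<Rightarrow> real) set" and n :: nat and p :: "'a list \<Rightarrow> real"
  assumes "n \<ge> 1"
    and "\<And>q. q \<in> M \<Longrightarrow> USSF q"
    and "SLC M \<le> enat (n - 1)"
    and "\<And>q a. q \<in> M \<Longrightarrow> shift [a] q \<in> M"
  shows "(\<lambda>u\<in>words (n + 1). p u) \<in> marginals M (n + 1) \<longleftrightarrow>
    (\<forall>a. (\<lambda>v\<in>words n. p (a # v)) \<in> marginals M n) \<and>
    (\<lambda>v\<in>words n. \<Sum>a\<in>UNIV. p (v @ [a])) \<in> marginals M n"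
  unfolding mem_marginals_iff
proof (intro iffI conjI allI)
  assume "\<exists>q\<in>M. \<forall>v. length v = n + 1 \<longrightarrow> p v = q v"
  then obtain q where q: "q \<in> M" "\<And>v. length v = n + 1 \<Longrightarrow> p v = q v"
    by blast
  show "\<exists>r\<in>M. \<forall>v. length v = n \<longrightarrow> p (a # v) = r v" for a
    using assms(4)[OF q(1), of a] q(2) by (intro bexI[of _ "shift [a] q"]) (auto simp: shift_def)
  show "\<exists>r\<in>M. \<forall>v. length v = n \<longrightarrow> (\<Sum>a\<in>UNIV. p (v @ [a])) = r v"
    \<comment> \<open>Summing \<open>q\<close> over the last letter returns \<open>q\<close>, so the
      same witness serves at length \<open>n\<close>.\<close>
    using q assms(2)[OF q(1)] by (intro bexI[of _ q]) (auto simp: USSF_sum)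
next
  assume "(\<forall>a. \<exists>r\<in>M. \<forall>v. length v = n \<longrightarrow> p (a # v) = r v) \<and>
    (\<exists>q\<in>M. \<forall>v. length v = n \<longrightarrow> (\<Sum>a\<in>UNIV. p (v @ [a])) = q v)"
  then obtain q where slices: "\<And>a. \<exists>r\<in>M. \<forall>v. length v = n \<longrightarrow> p (a # v) = r v"
    and q: "q \<in> M" "\<And>v. length v = n \<Longrightarrow> (\<Sum>a\<in>UNIV. p (v @ [a])) = q v"
    by blast
  have "p (a # v) = q (a # v)" if v: "length v = n" for a v
  proof -
    obtain r where r: "r \<in> M" "\<And>w. length w = n \<Longrightarrow> p (a # w) = r w"
      using slices by blast
    have "shift [a] q = r"
    proof (rule SLC_le_imp_eq[OF assms(3,2) assms(4)[OF q(1)] r(1)])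
      fix w :: "'a list"
      assume w: "length w = n - 1"
      \<comment> \<open>Since \<open>n \<ge> 1\<close>, both \<open>a # w\<close> and
        \<open>w @ [b]\<close> have length \<open>n\<close>: the first makes
        \<open>q (a # w)\<close> a marginal of \<open>p\<close>, the second turns
        \<open>p (a # w @ [b])\<close> into \<open>r (w @ [b])\<close>.\<close>
      have "shift [a] q w = (\<Sum>b\<in>UNIV. p (a # w @ [b]))"
        using q(2)[of "a # w"] w assms(1) by (simp add: shift_def)
      also have "\<dots> = (\<Sum>b\<in>UNIV. r (w @ [b]))"
        using r(2) w assms(1) by simp
      also have "\<dots> = r w"
        using assms(2)[OF r(1)] by (simp add: USSF_sum)
      finally show "shift [a] q w = r w" .
    qed
    then show ?thesis
      using r(2)[OF v] by (auto simp: shift_def)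
  qed
  then show "\<exists>q\<in>M. \<forall>v. length v = n + 1 \<longrightarrow> p v = q v"
    using q(1) by (auto simp: length_Suc_conv)
qed

end
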